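(* Let $G$ be a connected compact Lie group, $\theta$ an involutive automorphism of $G$, $H=G^{\theta}$, and $M=G/H$. Let $X$ be a subset of $M$ containing the origin $o=eH\in M$. Then $X$ is an antipodal set if and only if $\phi(x)\in H$ and $\phi(x)^{2}=1$ for any $x\in X$, and $\phi(x)$ commutes with $\phi(y)$ for any $x,y\in X$.
   Context: $G^{\theta}=\{g\in G:\theta(g)=g\}$, and $M=G/H$ with $H=G^{\theta}$ is regarded as a compact symmetric space, whose geodesic symmetries are given by $s_{o}(gH)=\theta(g)H$ at the origin $o=eH$ and, in general, by $s_{g_{1}H}(g_{2}H)=g_{1}\theta(g_{1}^{-1}g_{2})H$. A nonempty subset $X\subset M$ is an antipodal set if $s_{x}(y)=y$ for all $x,y\in X$. The Cartan quadratic morphism is the well-defined map $\phi:G/H\rightarrow G$, $\phi(gH)=g\theta(g)^{-1}$. *)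

theory Defs
  imports "HOL-Analysis.Analysis" "HOL-Algebra.Left_Coset"
begin

section \<open>Smooth maps between open sets of Euclidean spaces\<close>

text \<open>
  Lie groups are modelled on \<^term>\<open>Euclidean_space n\<close>, whose points are the
  \<^typ>\<open>nat \<Rightarrow> real\<close> vanishing from index \<^term>\<open>n\<close> on. The dimension is thus an ordinary
  natural number, and zero-dimensional groups are included.
\<close>

definition partial_deriv :: "nat \<Rightarrow> ((nat \<Rightarrow> real) \<Rightarrow> real) \<Rightarrow> (nat \<Rightarrow> real) \<Rightarrow> real" where
  "partial_deriv i f x = deriv (\<lambda>t. f (x(i := t))) (x i)"

text \<open>\<open>Ck_on n k U f\<close>: all partial derivatives of order at most \<open>k\<close> exist and are continuous on
  the set \<open>U\<close>, which is meant to be open in \<^term>\<open>Euclidean_space n\<close>.\<close>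

primrec Ck_on :: "nat \<Rightarrow> nat \<Rightarrow> (nat \<Rightarrow> real) set \<Rightarrow> ((nat \<Rightarrow> real) \<Rightarrow> real) \<Rightarrow> bool" where
  "Ck_on n 0 U f \<longleftrightarrow> continuous_map (subtopology (Euclidean_space n) U) euclideanreal f"
| "Ck_on n (Suc k) U f \<longleftrightarrow>
     continuous_map (subtopology (Euclidean_space n) U) euclideanreal f \<and>
     (\<forall>i<n. (\<forall>x\<in>U. (\<lambda>t. f (x(i := t))) differentiable (at (x i))) \<and>
            Ck_on n k U (partial_deriv i f))"

definition smooth_on ::
  "nat \<Rightarrow> nat \<Rightarrow> (nat \<Rightarrow> real) set \<Rightarrow> ((nat \<Rightarrow> real) \<Rightarrow> (nat \<Rightarrow> real)) \<Rightarrow> bool" where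
  "smooth_on n m U F \<longleftrightarrow>
     openin (Euclidean_space n) U \<and> F ` U \<subseteq> topspace (Euclidean_space m) \<and>
     (\<forall>j<m. \<forall>k. Ck_on n k U (\<lambda>x. F x j))"


section \<open>Smooth manifolds\<close>

type_synonym 'a atlas = "('a set \<times> ('a \<Rightarrow> nat \<Rightarrow> real)) set"

definition chart :: "nat \<Rightarrow> 'a topology \<Rightarrow> 'a set \<Rightarrow> ('a \<Rightarrow> nat \<Rightarrow> real) \<Rightarrow> bool" where
  "chart n T U \<phi> \<longleftrightarrow>
     openin T U \<and> openin (Euclidean_space n) (\<phi> ` U) \<and>
     homeomorphic_map (subtopology T U) (subtopology (Euclidean_space n) (\<phi> ` U)) \<phi>"

text \<open>The smooth structure is given by an arbitrary, not necessarily maximal, atlas.\<close>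

definition smooth_manifold :: "nat \<Rightarrow> 'a topology \<Rightarrow> 'a atlas \<Rightarrow> bool" where
  "smooth_manifold n T A \<longleftrightarrow>
     Hausdorff_space T \<and> second_countable T \<and>
     (\<Union>(U, \<phi>)\<in>A. U) = topspace T \<and>
     (\<forall>(U, \<phi>)\<in>A. chart n T U \<phi>) \<and>
     (\<forall>(U, \<phi>)\<in>A. \<forall>(V, \<psi>)\<in>A. smooth_on n n (\<phi> ` (U \<inter> V)) (\<psi> \<circ> inv_into U \<phi>))"

definition smooth_map ::
  "nat \<Rightarrow> 'a topology \<Rightarrow> 'a atlas \<Rightarrow> nat \<Rightarrow> 'b topology \<Rightarrow> 'b atlas \<Rightarrow> ('a \<Rightarrow> 'b) \<Rightarrow> bool" where
  "smooth_map n T A m S B f \<longleftrightarrow>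
     continuous_map T S f \<and>
     (\<forall>(U, \<phi>)\<in>A. \<forall>(V, \<psi>)\<in>B.
        smooth_on n m (\<phi> ` {x \<in> U. f x \<in> V}) (\<psi> \<circ> f \<circ> inv_into U \<phi>))"

definition concat_coords :: "nat \<Rightarrow> (nat \<Rightarrow> real) \<Rightarrow> (nat \<Rightarrow> real) \<Rightarrow> (nat \<Rightarrow> real)" where
  "concat_coords n x y = (\<lambda>i. if i < n then x i else y (i - n))"

definition prod_atlas :: "nat \<Rightarrow> 'a atlas \<Rightarrow> 'b atlas \<Rightarrow> ('a \<times> 'b) atlas" where
  "prod_atlas n A B =
     {(U \<times> V, \<lambda>(x, y). concat_coords n (\<phi> x) (\<psi> y)) | U \<phi> V \<psi>. (U, \<phi>) \<in> A \<and> (V, \<psi>) \<in> B}"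


section \<open>Lie groups and involutive automorphisms\<close>

locale lie_group = group G for G :: "('a, 'b) monoid_scheme" (structure) +
  fixes n :: nat and T :: "'a topology" and A :: "'a atlas"
  assumes manifold: "smooth_manifold n T A"
    and topspace_eq: "topspace T = carrier G"
    and smooth_mult:
      "smooth_map (n + n) (prod_topology T T) (prod_atlas n A A) n T A (\<lambda>(x, y). x \<otimes> y)"
    and smooth_inv: "smooth_map n T A n T A (\<lambda>x. inv x)"

text \<open>The identity is admitted as an involutive automorphism. The inverse of \<open>\<theta>\<close> is \<open>\<theta>\<close> itself,
  so its smoothness need not be required separately.\<close>

definition involutive_automorphism ::
  "('a, 'b) monoid_scheme \<Rightarrow> nat \<Rightarrow> 'a topology \<Rightarrow> 'a atlas \<Rightarrow> ('a \<Rightarrow> 'a) \<Rightarrow> bool" where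
  "involutive_automorphism G n T A \<theta> \<longleftrightarrow>
     \<theta> \<in> iso G G \<and> smooth_map n T A n T A \<theta> \<and> (\<forall>g\<in>carrier G. \<theta> (\<theta> g) = g)"

definition fixed_subgroup :: "('a, 'b) monoid_scheme \<Rightarrow> ('a \<Rightarrow> 'a) \<Rightarrow> 'a set" where
  "fixed_subgroup G \<theta> = {g \<in> carrier G. \<theta> g = g}"


section \<open>The symmetric space\<close>

text \<open>The points of \<open>M = G/H\<close> are the left cosets of \<open>H\<close>. The symmetries and the Cartan quadratic
  morphism are given by formulas in coset representatives; the lemmas below show that they do not
  depend on the representatives.\<close>

definition symmetric_space :: "('a, 'b) monoid_scheme \<Rightarrow> ('a \<Rightarrow> 'a) \<Rightarrow> 'a set set" where
  "symmetric_space G \<theta> = lcosets\<^bsub>G\<^esub> (fixed_subgroup G \<theta>)"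

definition origin :: "('a, 'b) monoid_scheme \<Rightarrow> ('a \<Rightarrow> 'a) \<Rightarrow> 'a set" where
  "origin G \<theta> = \<one>\<^bsub>G\<^esub> <#\<^bsub>G\<^esub> fixed_subgroup G \<theta>"

definition geodesic_symmetry ::
  "('a, 'b) monoid_scheme \<Rightarrow> ('a \<Rightarrow> 'a) \<Rightarrow> 'a set \<Rightarrow> 'a set \<Rightarrow> 'a set" where
  "geodesic_symmetry G \<theta> x y =
     (THE z. \<exists>g\<^sub>1\<in>carrier G. \<exists>g\<^sub>2\<in>carrier G.
        x = g\<^sub>1 <#\<^bsub>G\<^esub> fixed_subgroup G \<theta> \<and>
        y = g\<^sub>2 <#\<^bsub>G\<^esub> fixed_subgroup G \<theta> \<and>
        z = (g\<^sub>1 \<otimes>\<^bsub>G\<^esub> \<theta> (inv\<^bsub>G\<^esub> g\<^sub>1 \<otimes>\<^bsub>G\<^esub> g\<^sub>2)) <#\<^bsub>G\<^esub> fixed_subgroup G \<theta>)"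

definition antipodal_set :: "('a, 'b) monoid_scheme \<Rightarrow> ('a \<Rightarrow> 'a) \<Rightarrow> 'a set set \<Rightarrow> bool" where
  "antipodal_set G \<theta> X \<longleftrightarrow>
     X \<noteq> {} \<and> X \<subseteq> symmetric_space G \<theta> \<and> (\<forall>x\<in>X. \<forall>y\<in>X. geodesic_symmetry G \<theta> x y = y)"

definition cartan_morphism :: "('a, 'b) monoid_scheme \<Rightarrow> ('a \<Rightarrow> 'a) \<Rightarrow> 'a set \<Rightarrow> 'a" where
  "cartan_morphism G \<theta> x =
     (THE z. \<exists>g\<in>carrier G. x = g <#\<^bsub>G\<^esub> fixed_subgroup G \<theta> \<and> z = g \<otimes>\<^bsub>G\<^esub> inv\<^bsub>G\<^esub> (\<theta> g))"

context group
begin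

lemma fixed_subgroup_subgroup:
  assumes "\<theta> \<in> iso G G"
  shows "subgroup (fixed_subgroup G \<theta>) G"
proof -
  interpret \<theta>: group_hom G G \<theta>
    using assms by unfold_locales (auto simp: iso_def)
  show ?thesis
    by unfold_locales (auto simp: fixed_subgroup_def \<theta>.hom_inv)
qed

lemma fixed_coset_eqD:
  assumes "\<theta> \<in> iso G G" "g \<in> carrier G" "g' \<in> carrier G"
    and "g <# fixed_subgroup G \<theta> = g' <# fixed_subgroup G \<theta>"
  obtains h where "h \<in> carrier G" "\<theta> h = h" "g' = g \<otimes> h"
proof -
  have "g' \<in> g <# fixed_subgroup G \<theta>"
    using lcos_self fixed_subgroup_subgroup assms by metis
  then show thesis
    using that by (auto simp: l_coset_def fixed_subgroup_def)
qed

lemma cartan_morphism_coset: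
  assumes "\<theta> \<in> iso G G" "g \<in> carrier G"
  shows "cartan_morphism G \<theta> (g <# fixed_subgroup G \<theta>) = g \<otimes> inv (\<theta> g)"
  unfolding cartan_morphism_def
proof (rule the_equality)
  interpret \<theta>: group_hom G G \<theta>
    using assms by unfold_locales (auto simp: iso_def)
  fix z
  assume "\<exists>g'\<in>carrier G. g <# fixed_subgroup G \<theta> = g' <# fixed_subgroup G \<theta> \<and>
            z = g' \<otimes> inv (\<theta> g')"
  then obtain h where "h \<in> carrier G" "\<theta> h = h" "z = (g \<otimes> h) \<otimes> inv (\<theta> (g \<otimes> h))"
    by (metis fixed_coset_eqD assms)
  then show "z = g \<otimes> inv (\<theta> g)"
    using assms by (simp add: inv_mult_group m_assoc) (simp add: m_assoc [symmetric])
qed (use assms in auto)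

lemma geodesic_symmetry_coset:
  assumes "\<theta> \<in> iso G G" "g\<^sub>1 \<in> carrier G" "g\<^sub>2 \<in> carrier G"
  shows "geodesic_symmetry G \<theta> (g\<^sub>1 <# fixed_subgroup G \<theta>) (g\<^sub>2 <# fixed_subgroup G \<theta>) =
           (g\<^sub>1 \<otimes> \<theta> (inv g\<^sub>1 \<otimes> g\<^sub>2)) <# fixed_subgroup G \<theta>"
  unfolding geodesic_symmetry_def
proof (rule the_equality)
  interpret \<theta>: group_hom G G \<theta>
    using assms by unfold_locales (auto simp: iso_def)
  fix z
  assume "\<exists>a\<in>carrier G. \<exists>b\<in>carrier G.
      g\<^sub>1 <# fixed_subgroup G \<theta> = a <# fixed_subgroup G \<theta> \<and>
      g\<^sub>2 <# fixed_subgroup G \<theta> = b <# fixed_subgroup G \<theta> \<and>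
      z = (a \<otimes> \<theta> (inv a \<otimes> b)) <# fixed_subgroup G \<theta>"
  then obtain a b where ab: "a \<in> carrier G" "b \<in> carrier G"
      "g\<^sub>1 <# fixed_subgroup G \<theta> = a <# fixed_subgroup G \<theta>"
      "g\<^sub>2 <# fixed_subgroup G \<theta> = b <# fixed_subgroup G \<theta>"
      and z: "z = (a \<otimes> \<theta> (inv a \<otimes> b)) <# fixed_subgroup G \<theta>"
    by blast
  obtain h where h: "h \<in> carrier G" "\<theta> h = h" "a = g\<^sub>1 \<otimes> h"
    using fixed_coset_eqD assms ab by metis
  obtain k where k: "k \<in> carrier G" "\<theta> k = k" "b = g\<^sub>2 \<otimes> k"
    using fixed_coset_eqD assms ab by metis
  have "a \<otimes> \<theta> (inv a \<otimes> b) = (g\<^sub>1 \<otimes> h) \<otimes> (inv h \<otimes> (\<theta> (inv g\<^sub>1 \<otimes> g\<^sub>2) \<otimes> k))"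
    using assms h k by (simp add: inv_mult_group m_assoc)
  also have "\<dots> = (g\<^sub>1 \<otimes> \<theta> (inv g\<^sub>1 \<otimes> g\<^sub>2)) \<otimes> k"
  proof -
    have "h \<otimes> (inv h \<otimes> w) = w" if "w \<in> carrier G" for w
      using h(1) that by (simp add: m_assoc [symmetric])
    then show ?thesis
      using assms h(1) k(1) by (simp add: m_assoc)
  qed
  finally have eq: "a \<otimes> \<theta> (inv a \<otimes> b) = (g\<^sub>1 \<otimes> \<theta> (inv g\<^sub>1 \<otimes> g\<^sub>2)) \<otimes> k" .
  have H: "subgroup (fixed_subgroup G \<theta>) G"
    by (rule fixed_subgroup_subgroup [OF assms(1)])
  have "k <# fixed_subgroup G \<theta> = fixed_subgroup G \<theta>"
    using coset_join3 [OF k(1) H] k by (simp add: fixed_subgroup_def)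
  then have "((g\<^sub>1 \<otimes> \<theta> (inv g\<^sub>1 \<otimes> g\<^sub>2)) \<otimes> k) <# fixed_subgroup G \<theta> =
      (g\<^sub>1 \<otimes> \<theta> (inv g\<^sub>1 \<otimes> g\<^sub>2)) <# fixed_subgroup G \<theta>"
    using assms k(1) lcos_m_assoc [OF subgroup.subset [OF H], of "g\<^sub>1 \<otimes> \<theta> (inv g\<^sub>1 \<otimes> g\<^sub>2)" k]
    by simp
  then show "z = (g\<^sub>1 \<otimes> \<theta> (inv g\<^sub>1 \<otimes> g\<^sub>2)) <# fixed_subgroup G \<theta>"
    using z eq by simp
qed (use assms in auto)

end

end

theory Submission
  imports Defs
begin

text \<open>
  Write \<open>s\<^sub>x(y)\<close> for the geodesic symmetry at \<open>x\<close> and \<open>\<phi>\<close> for the Cartan quadratic morphism. The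
  map \<open>\<phi>\<close> embeds the symmetric space into the group and carries \<open>s\<close> to the symmetries of the group:
  it is injective (\<open>inj_on_cartan_morphism\<close>) and \<open>\<phi>(s\<^sub>x(y)) = \<phi>(x) \<phi>(y)\<^sup>-\<^sup>1 \<phi>(x)\<close>
  (\<open>cartan_morphism_geodesic_symmetry\<close>). Hence \<open>s\<^sub>x(y) = y\<close> is the equation
  \<open>p q\<^sup>-\<^sup>1 p = q\<close> between \<open>p = \<phi>(x)\<close> and \<open>q = \<phi>(y)\<close>, and antipodality of \<open>X\<close> becomes a statement
  about the set \<open>\<phi>(X)\<close>.

  The origin has image \<open>1\<close>. For \<open>p = 1\<close> the equation says that \<open>q\<close> is an involution or trivial,
  and once all elements of \<open>\<phi>(X)\<close> square to \<open>1\<close> it says that \<open>p\<close> and \<open>q\<close> commute. Finally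
  \<open>\<theta>\<close> inverts every value of \<open>\<phi>\<close>, so that lying in the fixed subgroup is for these values
  the same as squaring to \<open>1\<close>.
\<close>

context group
begin

lemma symmetric_spaceE:
  assumes "x \<in> symmetric_space G \<theta>"
  obtains g where "g \<in> carrier G" "x = g <# fixed_subgroup G \<theta>"
  using assms by (auto simp: symmetric_space_def LCOSETS_def)

lemma coset_in_symmetric_space:
  "g \<in> carrier G \<Longrightarrow> g <# fixed_subgroup G \<theta> \<in> symmetric_space G \<theta>"
  by (auto simp: symmetric_space_def LCOSETS_def)

lemma square_eq_one_iff_inv_eq:
  assumes "q \<in> carrier G"
  shows "q [^] (2::nat) = \<one> \<longleftrightarrow> inv q = q"
  using assms by (metis inv_equality l_inv nat_pow_Suc nat_pow_0 numeral_2_eq_2 l_one)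

lemma cartan_morphism_closed:
  assumes \<theta>: "\<theta> \<in> iso G G" and x: "x \<in> symmetric_space G \<theta>"
  shows "cartan_morphism G \<theta> x \<in> carrier G"
proof -
  interpret \<theta>: group_hom G G \<theta>
    using \<theta> by unfold_locales (auto simp: iso_def)
  show ?thesis
    using x by (auto elim!: symmetric_spaceE simp: cartan_morphism_coset [OF \<theta>])
qed

lemma cartan_morphism_origin:
  assumes \<theta>: "\<theta> \<in> iso G G"
  shows "cartan_morphism G \<theta> (origin G \<theta>) = \<one>"
proof -
  interpret \<theta>: group_hom G G \<theta>
    using \<theta> by unfold_locales (auto simp: iso_def)
  show ?thesis
    by (simp add: origin_def cartan_morphism_coset [OF \<theta>])
qed

text \<open>
  The equation \<open>a \<theta>(a)\<^sup>-\<^sup>1 = b \<theta>(b)\<^sup>-\<^sup>1\<close> rearranges to \<open>b\<^sup>-\<^sup>1 a = \<theta>(b\<^sup>-\<^sup>1 a)\<close>: it holds precisely when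
  \<open>a\<close> and \<open>b\<close> represent the same coset.
\<close>

lemma inj_on_cartan_morphism:
  assumes \<theta>: "\<theta> \<in> iso G G"
  shows "inj_on (cartan_morphism G \<theta>) (symmetric_space G \<theta>)"
proof (rule inj_onI)
  interpret \<theta>: group_hom G G \<theta>
    using \<theta> by unfold_locales (auto simp: iso_def)
  fix x y
  assume x: "x \<in> symmetric_space G \<theta>" and y: "y \<in> symmetric_space G \<theta>"
    and eq: "cartan_morphism G \<theta> x = cartan_morphism G \<theta> y"
  obtain a where a: "a \<in> carrier G" "x = a <# fixed_subgroup G \<theta>"
    using symmetric_spaceE [OF x] .
  obtain b where b: "b \<in> carrier G" "y = b <# fixed_subgroup G \<theta>"
    using symmetric_spaceE [OF y] .
  have "a \<otimes> inv (\<theta> a) = b \<otimes> inv (\<theta> b)"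
    using eq a b by (simp add: cartan_morphism_coset [OF \<theta>])
  then have "a = b \<otimes> inv (\<theta> b) \<otimes> \<theta> a"
    using a b by (metis \<theta>.hom_closed inv_closed inv_solve_right' m_closed)
  then have "inv b \<otimes> a = \<theta> (inv b \<otimes> a)"
    using a b by (metis \<theta>.hom_closed \<theta>.hom_inv \<theta>.hom_mult inv_closed inv_solve_left' m_assoc
        m_closed)
  then have h: "inv b \<otimes> a \<in> fixed_subgroup G \<theta>"
    unfolding fixed_subgroup_def using a(1) b(1)
    by (metis (mono_tags) inv_closed m_closed mem_Collect_eq)
  have H: "subgroup (fixed_subgroup G \<theta>) G"
    by (rule fixed_subgroup_subgroup [OF \<theta>])
  have "x = (b \<otimes> (inv b \<otimes> a)) <# fixed_subgroup G \<theta>"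
    using a b by (simp add: m_assoc [symmetric])
  also have "\<dots> = b <# ((inv b \<otimes> a) <# fixed_subgroup G \<theta>)"
    using a b lcos_m_assoc [OF subgroup.subset [OF H]] by simp
  also have "\<dots> = y"
    using a b coset_join3 [OF _ H h] by simp
  finally show "x = y" .
qed

lemma geodesic_symmetry_closed:
  assumes \<theta>: "\<theta> \<in> iso G G"
    and x: "x \<in> symmetric_space G \<theta>" and y: "y \<in> symmetric_space G \<theta>"
  shows "geodesic_symmetry G \<theta> x y \<in> symmetric_space G \<theta>"
proof -
  interpret \<theta>: group_hom G G \<theta>
    using \<theta> by unfold_locales (auto simp: iso_def)
  show ?thesis
    using x y
    by (auto elim!: symmetric_spaceE simp: geodesic_symmetry_coset [OF \<theta>]
        intro!: coset_in_symmetric_space)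
qed

lemma image_cartan_morphism:
  assumes \<theta>: "\<theta> \<in> iso G G" and invol: "\<forall>g\<in>carrier G. \<theta> (\<theta> g) = g"
    and x: "x \<in> symmetric_space G \<theta>"
  shows "\<theta> (cartan_morphism G \<theta> x) = inv (cartan_morphism G \<theta> x)"
proof -
  interpret \<theta>: group_hom G G \<theta>
    using \<theta> by unfold_locales (auto simp: iso_def)
  show ?thesis
    using x invol
    by (auto elim!: symmetric_spaceE simp: cartan_morphism_coset [OF \<theta>] inv_mult_group)
qed

text \<open>
  For \<open>x = aH\<close> and \<open>y = bH\<close> the point \<open>s\<^sub>x(y)\<close> is represented by \<open>a \<theta>(a\<^sup>-\<^sup>1 b) = \<phi>(x) \<theta>(b)\<close>. Since
  \<open>\<theta>\<close> inverts \<open>\<phi>(x)\<close> and is an involution, it sends this representative to \<open>\<phi>(x)\<^sup>-\<^sup>1 b\<close>, whose inverse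
  is \<open>b\<^sup>-\<^sup>1 \<phi>(x)\<close>. What remains between the two factors \<open>\<phi>(x)\<close> is \<open>\<theta>(b) b\<^sup>-\<^sup>1 = \<phi>(y)\<^sup>-\<^sup>1\<close>.
\<close>

lemma cartan_morphism_geodesic_symmetry:
  assumes \<theta>: "\<theta> \<in> iso G G" and invol: "\<forall>g\<in>carrier G. \<theta> (\<theta> g) = g"
    and x: "x \<in> symmetric_space G \<theta>" and y: "y \<in> symmetric_space G \<theta>"
  shows "cartan_morphism G \<theta> (geodesic_symmetry G \<theta> x y) =
    cartan_morphism G \<theta> x \<otimes> inv (cartan_morphism G \<theta> y) \<otimes> cartan_morphism G \<theta> x"
proof -
  interpret \<theta>: group_hom G G \<theta>
    using \<theta> by unfold_locales (auto simp: iso_def)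
  obtain a where a: "a \<in> carrier G" "x = a <# fixed_subgroup G \<theta>"
    using symmetric_spaceE [OF x] .
  obtain b where b: "b \<in> carrier G" "y = b <# fixed_subgroup G \<theta>"
    using symmetric_spaceE [OF y] .
  show ?thesis
    using a b invol
    by (simp add: geodesic_symmetry_coset [OF \<theta>] cartan_morphism_coset [OF \<theta>] inv_mult_group
        m_assoc)
qed

lemma geodesic_symmetry_fixes_iff:
  assumes \<theta>: "\<theta> \<in> iso G G" and invol: "\<forall>g\<in>carrier G. \<theta> (\<theta> g) = g"
    and x: "x \<in> symmetric_space G \<theta>" and y: "y \<in> symmetric_space G \<theta>"
  shows "geodesic_symmetry G \<theta> x y = y \<longleftrightarrow>
    cartan_morphism G \<theta> x \<otimes> inv (cartan_morphism G \<theta> y) \<otimes> cartan_morphism G \<theta> x =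
    cartan_morphism G \<theta> y"
  using inj_on_eq_iff [OF inj_on_cartan_morphism [OF \<theta>] geodesic_symmetry_closed [OF \<theta> x y] y]
  by (simp add: cartan_morphism_geodesic_symmetry [OF \<theta> invol x y])

text \<open>
  Since \<open>\<theta>\<close> inverts the values of \<open>\<phi>\<close>, each side says that \<open>\<phi>(x)\<close> is its own inverse.
\<close>

lemma cartan_morphism_fixed_iff:
  assumes \<theta>: "\<theta> \<in> iso G G" and invol: "\<forall>g\<in>carrier G. \<theta> (\<theta> g) = g"
    and x: "x \<in> symmetric_space G \<theta>"
  shows "cartan_morphism G \<theta> x \<in> fixed_subgroup G \<theta> \<longleftrightarrow>
    cartan_morphism G \<theta> x [^] (2::nat) = \<one>"
  using cartan_morphism_closed [OF \<theta> x] image_cartan_morphism [OF \<theta> invol x]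
  by (simp add: fixed_subgroup_def square_eq_one_iff_inv_eq)

lemma mult_inv_mult_eq_iff_commute:
  assumes "p \<in> carrier G" "q \<in> carrier G" "inv p = p" "inv q = q"
  shows "p \<otimes> inv q \<otimes> p = q \<longleftrightarrow> p \<otimes> q = q \<otimes> p"
  using assms by (metis inv_solve_right m_closed)

end

theorem proposition2p1:
  fixes G :: "('a, 'b) monoid_scheme" (structure)
    and n :: nat and T :: "'a topology" and A :: "'a atlas"
    and \<theta> :: "'a \<Rightarrow> 'a" and X :: "'a set set"
  assumes "lie_group G n T A"
    and "compact_space T"
    and "connected_space T"
    and "involutive_automorphism G n T A \<theta>"
    and "X \<subseteq> symmetric_space G \<theta>"
    and "origin G \<theta> \<in> X"
  shows "antipodal_set G \<theta> X \<longleftrightarrow>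
    (\<forall>x\<in>X. cartan_morphism G \<theta> x \<in> fixed_subgroup G \<theta> \<and>
            cartan_morphism G \<theta> x [^] (2::nat) = \<one>) \<and>
    (\<forall>x\<in>X. \<forall>y\<in>X. cartan_morphism G \<theta> x \<otimes> cartan_morphism G \<theta> y =
                      cartan_morphism G \<theta> y \<otimes> cartan_morphism G \<theta> x)"
proof -
  interpret lie_group G n T A
    by (rule assms(1))
  have \<theta>: "\<theta> \<in> iso G G" and invol: "\<forall>g\<in>carrier G. \<theta> (\<theta> g) = g"
    using assms(4) by (auto simp: involutive_automorphism_def)
  let ?\<phi> = "cartan_morphism G \<theta>"
  have X: "x \<in> symmetric_space G \<theta>" if "x \<in> X" for x
    using assms(5) that by blast
  have closed: "?\<phi> x \<in> carrier G" if "x \<in> X" for x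
    by (rule cartan_morphism_closed [OF \<theta> X [OF that]])
  have antipodal: "antipodal_set G \<theta> X \<longleftrightarrow> (\<forall>x\<in>X. \<forall>y\<in>X. ?\<phi> x \<otimes> inv (?\<phi> y) \<otimes> ?\<phi> x = ?\<phi> y)"
    using assms(5,6) geodesic_symmetry_fixes_iff [OF \<theta> invol X X]
    by (auto simp: antipodal_set_def)
  have involutions: "(\<forall>x\<in>X. ?\<phi> x \<in> fixed_subgroup G \<theta> \<and> ?\<phi> x [^] (2::nat) = \<one>) \<longleftrightarrow>
      (\<forall>x\<in>X. inv (?\<phi> x) = ?\<phi> x)"
    using cartan_morphism_fixed_iff [OF \<theta> invol X] square_eq_one_iff_inv_eq [OF closed] by auto
  have commute: "?\<phi> x \<otimes> inv (?\<phi> y) \<otimes> ?\<phi> x = ?\<phi> y \<longleftrightarrow> ?\<phi> x \<otimes> ?\<phi> y = ?\<phi> y \<otimes> ?\<phi> x"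
    if "\<forall>x\<in>X. inv (?\<phi> x) = ?\<phi> x" "x \<in> X" "y \<in> X" for x y
    using that closed by (intro mult_inv_mult_eq_iff_commute) auto
  have "\<forall>y\<in>X. inv (?\<phi> y) = ?\<phi> y"
    if "\<forall>x\<in>X. \<forall>y\<in>X. ?\<phi> x \<otimes> inv (?\<phi> y) \<otimes> ?\<phi> x = ?\<phi> y"
  proof
    fix y assume y: "y \<in> X"
    \<comment> \<open>The symmetry at the origin is the one that forces \<open>\<phi>(y)\<close> to be its own inverse.\<close>
    have "?\<phi> (origin G \<theta>) \<otimes> inv (?\<phi> y) \<otimes> ?\<phi> (origin G \<theta>) = ?\<phi> y"
      using that assms(6) y by blast
    then show "inv (?\<phi> y) = ?\<phi> y"
      using closed [OF y] by (simp add: cartan_morphism_origin [OF \<theta>])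
  qed
  then show ?thesis
    unfolding antipodal involutions using commute by blast
qed

end
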